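(* Consider the decision-dependent distributionally robust facility location problem $$\min_{y\in\mathcal{Y}}\Bigl\{\sum_{i\in I}f_iy_i+\max_{\pi\in U(y)}\mathbf{E}_\pi[h(y,d(y))]\Bigr\}\qquad(\mathrm{P})$$ with all data as defined in the context (including the assumption that the upper bounds $\overline{\delta_j^1},\overline{\delta_j^2},\overline{\gamma_j^1},\overline{\gamma_j^2}$ are valid). Then (P) is equivalent to the following mixed-integer linear program in the variables $y,\alpha,\delta^h,\gamma^h,\Delta^h,\Gamma^h,\Psi^h$ ($h=1,2$): $$\begin{aligned}\min\ \ &\sum_{i\in I}f_iy_i+\sum_{j\in J}\Bigl(\alpha_j+\delta_j^1(\bar\mu_j+\epsilon_j^\mu)-\delta_j^2(\bar\mu_j-\epsilon_j^\mu)+\bar\mu_j\sum_{j'\in I}\lambda^\mu_{jj'}(\Delta^1_{jj'}-\Delta^2_{jj'})\\&+(\bar\sigma_j^2+\bar\mu_j^2)(\overline{\epsilon}_j^\sigma\gamma_j^1-\underline{\epsilon}_j^\sigma\gamma_j^2)+\sum_{j'\in I}\Lambda_{jj'}(\overline{\epsilon}_j^\sigma\Gamma^1_{jj'}-\underline{\epsilon}_j^\sigma\Gamma^2_{jj'})\\&+2\bar\mu_j^2\sum_{l=1}^{|I|}\sum_{m=1}^{l-1}\lambda^\mu_{jl}\lambda^\mu_{jm}(\overline{\epsilon}_j^\sigma\Psi^1_{jlm}-\underline{\epsilon}_j^\sigma\Psi^2_{jlm})\Bigr)\end{aligned}$$ subject to $$\alpha_j+(\delta_j^1-\delta_j^2)d_k+(\gamma_j^1-\gamma_j^2)d_k^2\ge(c_{i^*j}-r_j)d_k+\sum_{i\in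 I:\,c_{ij}<c_{i^*j}}C_iy_i(c_{ij}-c_{i^*j})\quad\forall i^*\in I\cup\{0\},\ j\in J,\ k=1,\dots,K,$$ $$(\Delta^h_{jj'},\delta^h_j,y_{j'})\in M'_{(0,\overline{\delta_j^h})},\quad(\Gamma^h_{jj'},\gamma^h_j,y_{j'})\in M'_{(0,\overline{\gamma_j^h})}\quad\forall j\in J,\ j'\in I,\ h=1,2,$$ $$(\Psi^h_{jlm},\gamma^h_j,y_l,y_m)\in M''_{(0,\overline{\gamma_j^h})}\quad\forall j\in J,\ 1\le m<l\le|I|,\ h=1,2,$$ $$y\in\mathcal{Y},\quad\alpha_j\in\mathbb{R},\quad\delta_j^1,\delta_j^2,\gamma_j^1,\gamma_j^2\ge0\quad\forall j\in J,$$ where $c_{0j}:=p_j$ and $\Lambda_{jj'}:=-\bar\sigma_j^2\lambda^\sigma_{jj'}+\bar\mu_j^2\bigl(2\lambda^\mu_{jj'}+(\lambda^\mu_{jj'})^2\bigr)$. That is, for every $y\in\mathcal{Y}$ the objective value of (P) at $y$ equals the optimal value of this program over the remaining variables with that $y$ fixed; in particular the two problems have the same optimal value and the same optimal $y$.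
   Context: Setting. $I=\{1,\dots,|I|\}$ (facility locations) and $J$ (customer sites) are finite nonempty sets; $\mathcal{Y}\subseteq\{0,1\}^{|I|}$ ($\mathcal{Y}$ is described by linear constraints together with integrality). Data: $f_i,c_{ij},p_j,r_j\in\mathbb{R}$ with $p_j>c_{ij}$ for all $i\in I,j\in J$; $C_i\ge 0$. The support of each site's demand is $\mathcal{K}=\{d_1,\dots,d_K\}$, a set of nonnegative reals. Moment functions (without truncation at market upper bounds on the mean or lower bounds on the variance). Given $\bar\mu_j\ge0$, $\bar\sigma_j^2\ge0$, and $\lambda^\mu_{jj'},\lambda^\sigma_{jj'}\in[0,1]$ with $\sum_{j'\in I}\lambda^\sigma_{jj'}<1$ for all $j\in J$, $$\mu_j(y)=\bar\mu_j\Bigl(1+\sum_{j'\in I}\lambda^\mu_{jj'}y_{j'}\Bigr),\qquad\sigma_j^2(y)=\bar\sigma_j^2\Bigl(1-\sum_{j'\in I}\lambda^\sigma_{jj'}y_{j'}\Bigr).$$ Ambiguity set. With parameters $\epsilon_j^\mu\ge0$ and $0\le\underline{\epsilon}_j^\sigma\le1\le\overline{\epsilon}_j^\sigma$, $U(y)$ is the set of $\pi=(\pi_{jk})_{j\in J,\,1\le k\le K}$ with $\pi_{jk}\ge0$ such that for all $j\in J$: $\sum_{k}\pi_{jk}=1$; $\bigl|\sum_k\pi_{jk}d_k-\mu_j(y)\bigr|\le\epsilon_j^\mu$; and $(\sigma_j^2(y)+(\mu_j(y))^2)\underline{\epsilon}_j^\sigma\le\sum_k\pi_{jk}d_k^2\le(\sigma_j^2(y)+(\mu_j(y))^2)\overline{\epsilon}_j^\sigma$.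 Second stage. For a demand realization $d(y)=(d_j(y))_{j\in J}$, $h(y,d(y))$ is the minimum of $\sum_{i\in I}\sum_{j\in J}c_{ij}x_{ij}+\sum_{j\in J}(p_js_j-r_jd_j(y))$ over $x_{ij}\ge0$, $s_j\ge0$ with $\sum_{i\in I}x_{ij}+s_j=d_j(y)$ for all $j\in J$ and $x_{ij}\le C_iy_i$ for all $i\in I,j\in J$. $\mathbf{E}_\pi$ denotes expectation when the random demand at site $j$ takes value $d_k$ with probability $\pi_{jk}$; since $h$ is a sum over $j\in J$ of functions of $d_j(y)$, only these marginals matter. McCormick sets. For $u\ge0$, $$M'_{(0,u)}=\{(w',\eta,z)\in\mathbb{R}^3:\ \eta-(1-z)u\le w'\le\eta,\ 0\le w'\le uz\},$$ $$M''_{(0,u)}=\{(w'',\eta,z_1,z_2)\in\mathbb{R}^4:\ w''\le uz_1,\ w''\le uz_2,\ w''\le\eta,\ w''\ge0,\ w''\ge\eta+u(-2+z_1+z_2),\ z_1\le1,\ z_2\le1,\ 0\le\eta\le u\}.$$ Assumption on upper bounds. $\overline{\delta_j^1},\overline{\delta_j^2},\overline{\gamma_j^1},\overline{\gamma_j^2}\ge0$ are valid upper bounds on the dual variables of the inner maximization: for every $y\in\mathcal{Y}$, the linear program $$\min\ \sum_{j\in J}\Bigl(\alpha_j+\delta_j^1(\mu_j(y)+\epsilon_j^\mu)-\delta_j^2(\mu_j(y)-\epsilon_j^\mu)+\gamma_j^1(\sigma_j^2(y)+(\mu_j(y))^2)\overline{\epsilon}_j^\sigma-\gamma_j^2(\sigma_j^2(y)+(\mu_j(y))^2)\underline{\epsilon}_j^\sigma\Bigr)$$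 over $\alpha_j\in\mathbb{R}$, $\delta_j^1,\delta_j^2,\gamma_j^1,\gamma_j^2\ge0$ subject to $\alpha_j+(\delta_j^1-\delta_j^2)d_k+(\gamma_j^1-\gamma_j^2)d_k^2\ge\max_{i^*\in I\cup\{0\}}\bigl\{c_{i^*j}d_k+\sum_{i\in I:\,c_{ij}<c_{i^*j}}C_iy_i(c_{ij}-c_{i^*j})\bigr\}-r_jd_k$ for all $j\in J$, $k=1,\dots,K$ (with $c_{0j}=p_j$) has an optimal solution satisfying $\delta_j^h\le\overline{\delta_j^h}$ and $\gamma_j^h\le\overline{\gamma_j^h}$ for all $j\in J$, $h=1,2$. *)

theory Defs
  imports "HOL-Probability.Probability"
begin

text \<open>
  Facilities are the indices \<open>1..nfac\<close>; index \<open>0\<close> is reserved for the artificial facility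
  of unmet demand, see \<open>ext_cost\<close>.  Demand values \<open>demand k\<close> are indexed by \<open>1..nval\<close>.
  \<open>var_bar j\<close> and \<open>lam_var\<close> stand for the parameters \<open>\<sigma>\<close>-bar squared and \<open>\<lambda>\<close>-sigma;
  \<open>eps_lo\<close>, \<open>eps_hi\<close> are the lower and upper factors of the second-moment constraint.
\<close>

record 'j fl_data =
  nfac :: nat
  sites :: "'j set"
  decisions :: "(nat \<Rightarrow> real) set"
  open_cost :: "nat \<Rightarrow> real"
  ship_cost :: "nat \<Rightarrow> 'j \<Rightarrow> real"
  penalty :: "'j \<Rightarrow> real"
  revenue :: "'j \<Rightarrow> real"
  capacity :: "nat \<Rightarrow> real"
  nval :: nat
  demand :: "nat \<Rightarrow> real"
  mu_bar :: "'j \<Rightarrow> real"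
  var_bar :: "'j \<Rightarrow> real"
  lam_mu :: "'j \<Rightarrow> nat \<Rightarrow> real"
  lam_var :: "'j \<Rightarrow> nat \<Rightarrow> real"
  eps_mu :: "'j \<Rightarrow> real"
  eps_lo :: "'j \<Rightarrow> real"
  eps_hi :: "'j \<Rightarrow> real"

definition facs :: "'j fl_data \<Rightarrow> nat set" where
  "facs D = {1..nfac D}"

definition well_formed :: "'j fl_data \<Rightarrow> bool" where
  "well_formed D \<longleftrightarrow>
     nfac D \<ge> 1 \<and> finite (sites D) \<and> sites D \<noteq> {} \<and>
     decisions D \<subseteq> (facs D \<rightarrow>\<^sub>E {0, 1}) \<and>
     (\<forall>i\<in>facs D. \<forall>j\<in>sites D. ship_cost D i j < penalty D j) \<and>
     (\<forall>i\<in>facs D. capacity D i \<ge> 0) \<and>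
     (\<forall>k\<in>{1..nval D}. demand D k \<ge> 0) \<and>
     (\<forall>j\<in>sites D. mu_bar D j \<ge> 0 \<and> var_bar D j \<ge> 0) \<and>
     (\<forall>j\<in>sites D. \<forall>i\<in>facs D. lam_mu D j i \<in> {0..1} \<and> lam_var D j i \<in> {0..1}) \<and>
     (\<forall>j\<in>sites D. (\<Sum>i\<in>facs D. lam_var D j i) < 1) \<and>
     (\<forall>j\<in>sites D. eps_mu D j \<ge> 0 \<and> 0 \<le> eps_lo D j \<and> eps_lo D j \<le> 1 \<and> 1 \<le> eps_hi D j)"

definition mean_fn :: "'j fl_data \<Rightarrow> (nat \<Rightarrow> real) \<Rightarrow> 'j \<Rightarrow> real" where
  "mean_fn D y j = mu_bar D j * (1 + (\<Sum>i\<in>facs D. lam_mu D j i * y i))"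

definition var_fn :: "'j fl_data \<Rightarrow> (nat \<Rightarrow> real) \<Rightarrow> 'j \<Rightarrow> real" where
  "var_fn D y j = var_bar D j * (1 - (\<Sum>i\<in>facs D. lam_var D j i * y i))"

definition ambiguity_set :: "'j fl_data \<Rightarrow> (nat \<Rightarrow> real) \<Rightarrow> ('j \<Rightarrow> nat \<Rightarrow> real) set" where
  "ambiguity_set D y = {\<pi>. \<forall>j\<in>sites D.
     (\<forall>k\<in>{1..nval D}. \<pi> j k \<ge> 0) \<and>
     (\<Sum>k\<in>{1..nval D}. \<pi> j k) = 1 \<and>
     \<bar>(\<Sum>k\<in>{1..nval D}. \<pi> j k * demand D k) - mean_fn D y j\<bar> \<le> eps_mu D j \<and>
     (var_fn D y j + (mean_fn D y j)\<^sup>2) * eps_lo D j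
       \<le> (\<Sum>k\<in>{1..nval D}. \<pi> j k * (demand D k)\<^sup>2) \<and>
     (\<Sum>k\<in>{1..nval D}. \<pi> j k * (demand D k)\<^sup>2)
       \<le> (var_fn D y j + (mean_fn D y j)\<^sup>2) * eps_hi D j}"

definition recourse_feasible ::
  "'j fl_data \<Rightarrow> (nat \<Rightarrow> real) \<Rightarrow> ('j \<Rightarrow> real) \<Rightarrow> (nat \<Rightarrow> 'j \<Rightarrow> real) \<Rightarrow> ('j \<Rightarrow> real) \<Rightarrow> bool" where
  "recourse_feasible D y dem x s \<longleftrightarrow>
     (\<forall>i\<in>facs D. \<forall>j\<in>sites D. 0 \<le> x i j \<and> x i j \<le> capacity D i * y i) \<and>
     (\<forall>j\<in>sites D. 0 \<le> s j \<and> (\<Sum>i\<in>facs D. x i j) + s j = dem j)"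

definition recourse_cost ::
  "'j fl_data \<Rightarrow> ('j \<Rightarrow> real) \<Rightarrow> (nat \<Rightarrow> 'j \<Rightarrow> real) \<Rightarrow> ('j \<Rightarrow> real) \<Rightarrow> real" where
  "recourse_cost D dem x s =
     (\<Sum>i\<in>facs D. \<Sum>j\<in>sites D. ship_cost D i j * x i j) +
     (\<Sum>j\<in>sites D. penalty D j * s j - revenue D j * dem j)"

text \<open>\<open>LEAST\<close> is a genuine minimum: it is unspecified if no minimum is attained.\<close>

definition second_stage :: "'j fl_data \<Rightarrow> (nat \<Rightarrow> real) \<Rightarrow> ('j \<Rightarrow> real) \<Rightarrow> real" where
  "second_stage D y dem =
     (LEAST v. \<exists>x s. recourse_feasible D y dem x s \<and> v = recourse_cost D dem x s)"

text \<open>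
  A vector \<open>\<pi>\<close> prescribes only the marginals of the random demand vector, not the dependence
  between sites.  \<open>has_marginals D \<pi> Q\<close> says that \<open>Q\<close> is some joint law with these marginals.
  The sum merges indices carrying the same demand value, so the values need not be distinct.
\<close>

definition has_marginals ::
  "'j fl_data \<Rightarrow> ('j \<Rightarrow> nat \<Rightarrow> real) \<Rightarrow> ('j \<Rightarrow> real) pmf \<Rightarrow> bool" where
  "has_marginals D \<pi> Q \<longleftrightarrow>
     (\<forall>j\<in>sites D. \<forall>t. measure_pmf.prob Q {dem. dem j = t} =
        (\<Sum>k | k \<in> {1..nval D} \<and> demand D k = t. \<pi> j k))"

text \<open>
  In the next three definitions \<open>Q y \<pi>\<close> is the joint law under which the expectation for
  the marginals \<open>\<pi>\<close> at the decision \<open>y\<close> is taken.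
\<close>

definition expected_cost ::
  "'j fl_data \<Rightarrow> ((nat \<Rightarrow> real) \<Rightarrow> ('j \<Rightarrow> nat \<Rightarrow> real) \<Rightarrow> ('j \<Rightarrow> real) pmf) \<Rightarrow>
   (nat \<Rightarrow> real) \<Rightarrow> ('j \<Rightarrow> nat \<Rightarrow> real) \<Rightarrow> real" where
  "expected_cost D Q y \<pi> = measure_pmf.expectation (Q y \<pi>) (second_stage D y)"

definition dro_objective ::
  "'j fl_data \<Rightarrow> ((nat \<Rightarrow> real) \<Rightarrow> ('j \<Rightarrow> nat \<Rightarrow> real) \<Rightarrow> ('j \<Rightarrow> real) pmf) \<Rightarrow>
   (nat \<Rightarrow> real) \<Rightarrow> ereal" where
  "dro_objective D Q y =
     ereal (\<Sum>i\<in>facs D. open_cost D i * y i) +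
     (SUP \<pi>\<in>ambiguity_set D y. ereal (expected_cost D Q y \<pi>))"

definition dro_optimal ::
  "'j fl_data \<Rightarrow> ((nat \<Rightarrow> real) \<Rightarrow> ('j \<Rightarrow> nat \<Rightarrow> real) \<Rightarrow> ('j \<Rightarrow> real) pmf) \<Rightarrow>
   (nat \<Rightarrow> real) \<Rightarrow> bool" where
  "dro_optimal D Q y \<longleftrightarrow>
     y \<in> decisions D \<and> (\<forall>y'\<in>decisions D. dro_objective D Q y \<le> dro_objective D Q y')"

definition ext_cost :: "'j fl_data \<Rightarrow> nat \<Rightarrow> 'j \<Rightarrow> real" where
  "ext_cost D i j = (if i = 0 then penalty D j else ship_cost D i j)"

text \<open>
  The superscript \<open>h \<in> {1, 2}\<close> of the multipliers is the first argument of the function fields.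
\<close>

record 'j dual_vars =
  v_alpha :: "'j \<Rightarrow> real"
  v_delta :: "nat \<Rightarrow> 'j \<Rightarrow> real"
  v_gamma :: "nat \<Rightarrow> 'j \<Rightarrow> real"

record 'j milp_vars = "'j dual_vars" +
  v_Delta :: "nat \<Rightarrow> 'j \<Rightarrow> nat \<Rightarrow> real"
  v_Gamma :: "nat \<Rightarrow> 'j \<Rightarrow> nat \<Rightarrow> real"
  v_Psi :: "nat \<Rightarrow> 'j \<Rightarrow> nat \<Rightarrow> nat \<Rightarrow> real"

record 'j dual_bounds =
  ub_delta :: "nat \<Rightarrow> 'j \<Rightarrow> real"
  ub_gamma :: "nat \<Rightarrow> 'j \<Rightarrow> real"

definition dual_feasible :: "'j fl_data \<Rightarrow> (nat \<Rightarrow> real) \<Rightarrow> 'j dual_vars \<Rightarrow> bool" where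
  "dual_feasible D y v \<longleftrightarrow>
     (\<forall>h\<in>{1, 2}. \<forall>j\<in>sites D. v_delta v h j \<ge> 0 \<and> v_gamma v h j \<ge> 0) \<and>
     (\<forall>j\<in>sites D. \<forall>k\<in>{1..nval D}.
        v_alpha v j + (v_delta v 1 j - v_delta v 2 j) * demand D k
          + (v_gamma v 1 j - v_gamma v 2 j) * (demand D k)\<^sup>2
        \<ge> (MAX i'\<in>insert 0 (facs D).
             ext_cost D i' j * demand D k +
             (\<Sum>i | i \<in> facs D \<and> ship_cost D i j < ext_cost D i' j.
                capacity D i * y i * (ship_cost D i j - ext_cost D i' j)))
          - revenue D j * demand D k)"

definition dual_objective :: "'j fl_data \<Rightarrow> (nat \<Rightarrow> real) \<Rightarrow> 'j dual_vars \<Rightarrow> real" where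
  "dual_objective D y v =
     (\<Sum>j\<in>sites D.
        v_alpha v j
        + v_delta v 1 j * (mean_fn D y j + eps_mu D j)
        - v_delta v 2 j * (mean_fn D y j - eps_mu D j)
        + v_gamma v 1 j * (var_fn D y j + (mean_fn D y j)\<^sup>2) * eps_hi D j
        - v_gamma v 2 j * (var_fn D y j + (mean_fn D y j)\<^sup>2) * eps_lo D j)"

definition valid_bounds :: "'j fl_data \<Rightarrow> 'j dual_bounds \<Rightarrow> bool" where
  "valid_bounds D B \<longleftrightarrow>
     (\<forall>h\<in>{1, 2}. \<forall>j\<in>sites D. ub_delta B h j \<ge> 0 \<and> ub_gamma B h j \<ge> 0) \<and>
     (\<forall>y\<in>decisions D. \<exists>v.
        dual_feasible D y v \<and>
        (\<forall>v'. dual_feasible D y v' \<longrightarrow> dual_objective D y v \<le> dual_objective D y v') \<and>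
        (\<forall>h\<in>{1, 2}. \<forall>j\<in>sites D.
           v_delta v h j \<le> ub_delta B h j \<and> v_gamma v h j \<le> ub_gamma B h j))"

definition mccormick2 :: "real \<Rightarrow> (real \<times> real \<times> real) set" where
  "mccormick2 u = {(w, \<eta>, z). \<eta> - (1 - z) * u \<le> w \<and> w \<le> \<eta> \<and> 0 \<le> w \<and> w \<le> u * z}"

definition mccormick3 :: "real \<Rightarrow> (real \<times> real \<times> real \<times> real) set" where
  "mccormick3 u = {(w, \<eta>, z1, z2).
     w \<le> u * z1 \<and> w \<le> u * z2 \<and> w \<le> \<eta> \<and> w \<ge> 0 \<and> w \<ge> \<eta> + u * (-2 + z1 + z2) \<and>
     z1 \<le> 1 \<and> z2 \<le> 1 \<and> 0 \<le> \<eta> \<and> \<eta> \<le> u}"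

definition lam_big :: "'j fl_data \<Rightarrow> 'j \<Rightarrow> nat \<Rightarrow> real" where
  "lam_big D j i =
     - var_bar D j * lam_var D j i + (mu_bar D j)\<^sup>2 * (2 * lam_mu D j i + (lam_mu D j i)\<^sup>2)"

definition milp_feasible ::
  "'j fl_data \<Rightarrow> 'j dual_bounds \<Rightarrow> (nat \<Rightarrow> real) \<Rightarrow> 'j milp_vars \<Rightarrow> bool" where
  "milp_feasible D B y v \<longleftrightarrow>
     y \<in> decisions D \<and>
     (\<forall>h\<in>{1, 2}. \<forall>j\<in>sites D. v_delta v h j \<ge> 0 \<and> v_gamma v h j \<ge> 0) \<and>
     (\<forall>i'\<in>insert 0 (facs D). \<forall>j\<in>sites D. \<forall>k\<in>{1..nval D}.
        v_alpha v j + (v_delta v 1 j - v_delta v 2 j) * demand D k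
          + (v_gamma v 1 j - v_gamma v 2 j) * (demand D k)\<^sup>2
        \<ge> (ext_cost D i' j - revenue D j) * demand D k +
          (\<Sum>i | i \<in> facs D \<and> ship_cost D i j < ext_cost D i' j.
             capacity D i * y i * (ship_cost D i j - ext_cost D i' j))) \<and>
     (\<forall>h\<in>{1, 2}. \<forall>j\<in>sites D. \<forall>i\<in>facs D.
        (v_Delta v h j i, v_delta v h j, y i) \<in> mccormick2 (ub_delta B h j) \<and>
        (v_Gamma v h j i, v_gamma v h j, y i) \<in> mccormick2 (ub_gamma B h j)) \<and>
     (\<forall>h\<in>{1, 2}. \<forall>j\<in>sites D. \<forall>l\<in>facs D. \<forall>m\<in>facs D. m < l \<longrightarrow>
        (v_Psi v h j l m, v_gamma v h j, y l, y m) \<in> mccormick3 (ub_gamma B h j))"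

definition milp_objective :: "'j fl_data \<Rightarrow> (nat \<Rightarrow> real) \<Rightarrow> 'j milp_vars \<Rightarrow> real" where
  "milp_objective D y v =
     (\<Sum>i\<in>facs D. open_cost D i * y i) +
     (\<Sum>j\<in>sites D.
        v_alpha v j
        + v_delta v 1 j * (mu_bar D j + eps_mu D j)
        - v_delta v 2 j * (mu_bar D j - eps_mu D j)
        + mu_bar D j * (\<Sum>i\<in>facs D. lam_mu D j i * (v_Delta v 1 j i - v_Delta v 2 j i))
        + (var_bar D j + (mu_bar D j)\<^sup>2)
            * (eps_hi D j * v_gamma v 1 j - eps_lo D j * v_gamma v 2 j)
        + (\<Sum>i\<in>facs D. lam_big D j i
            * (eps_hi D j * v_Gamma v 1 j i - eps_lo D j * v_Gamma v 2 j i))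
        + 2 * (mu_bar D j)\<^sup>2 * (\<Sum>l = 1..nfac D. \<Sum>m = 1..<l.
            lam_mu D j l * lam_mu D j m
            * (eps_hi D j * v_Psi v 1 j l m - eps_lo D j * v_Psi v 2 j l m)))"

definition milp_optimal ::
  "'j fl_data \<Rightarrow> 'j dual_bounds \<Rightarrow> (nat \<Rightarrow> real) \<Rightarrow> 'j milp_vars \<Rightarrow> bool" where
  "milp_optimal D B y v \<longleftrightarrow>
     milp_feasible D B y v \<and>
     (\<forall>y' v'. milp_feasible D B y' v' \<longrightarrow> milp_objective D y v \<le> milp_objective D y' v')"

end

theory Submission
  imports Defs
begin

text \<open>
  The second stage separates over the sites.  At one site it is a transport problem with a
  single sink, whose Lagrangian dual in the price \<open>l\<close> of demand is piecewise linear and concave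
  on \<open>l \<le> p\<close>, with break points at the costs \<open>c\<^sub>i\<close>.  Weak duality holds at every
  \<open>l \<le> p\<close>, and the greedy plan matches the dual value at its marginal cost.  So the
  minimum is the maximum over the break points and \<open>p\<close> (\<open>second_stage_eq\<close>).  Being a sum over sites, its
  expectation under any joint law depends on the marginals only (\<open>expected_cost_eq\<close>).

  For a fixed decision, the inner maximization is thus, at each site, the linear program of
  maximizing \<open>\<Sum>\<^sub>k p\<^sub>k g\<^sub>k\<close> over probability vectors \<open>p\<close> whose first two moments lie in a
  box.  Strong duality (\<open>moment_strong_duality\<close>) follows from separation in three dimensions: if
  the value \<open>V\<close> of the dual optimum were not attained, the polytope spanned by the points
  \<open>(d\<^sub>k, d\<^sub>k\<^sup>2, g\<^sub>k)\<close> would be disjoint from the closed convex set of points of the box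
  with last coordinate at least \<open>V\<close>, and a strictly separating hyperplane would give multipliers
  of smaller dual value.  Primal feasibility need not be assumed: it is a consequence of the
  existence of a dual optimum.  A joint dual optimum is optimal at each site, so the optimal
  distributions of the sites together form a worst case (\<open>worst_case_eq_dual\<close>).

  Finally, the McCormick inequalities at a binary \<open>y\<close> say that the auxiliary variables are the
  products that they stand for and that the multipliers respect their bounds
  (\<open>milp_feasible_iff\<close>).  Expanding \<open>\<mu>\<^sup>2\<close> with \<open>y\<^sub>i\<^sup>2 = y\<^sub>i\<close> then turns the dual objective
  into the objective of the mixed-integer program (\<open>milp_objective_eq\<close>).  Bounding the
  multipliers loses nothing, because some dual optimum satisfies the bounds.
\<close>

section \<open>The transport problem of a single site\<close>

text \<open>
  Facilities in \<open>I\<close> have unit costs \<open>c\<close> and capacities \<open>u\<close>; unmet demand \<open>s\<close> costs \<open>p\<close> per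
  unit.  This is weak duality for the Lagrangian relaxation of the demand equation.
\<close>

lemma transport_cost_ge:
  fixes c u x :: "'i \<Rightarrow> real"
  assumes "finite I" and x: "\<And>i. i \<in> I \<Longrightarrow> 0 \<le> x i \<and> x i \<le> u i" and "0 \<le> s"
    and t: "(\<Sum>i\<in>I. x i) + s = t" and "l \<le> p"
  shows "l * t + (\<Sum>i | i \<in> I \<and> c i < l. u i * (c i - l)) \<le> (\<Sum>i\<in>I. c i * x i) + p * s"
proof -
  have "(\<Sum>i | i \<in> I \<and> c i < l. u i * (c i - l)) = (\<Sum>i\<in>I. if c i < l then u i * (c i - l) else 0)"
    using \<open>finite I\<close> by (simp add: sum.If_cases Int_def)
  also have "\<dots> \<le> (\<Sum>i\<in>I. x i * (c i - l))"
    using x by (intro sum_mono) (auto intro: mult_right_mono_neg)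
  also have "\<dots> = (\<Sum>i\<in>I. c i * x i) - l * (\<Sum>i\<in>I. x i)"
    by (simp add: algebra_simps sum_subtractf sum_distrib_left)
  finally have *: "(\<Sum>i | i \<in> I \<and> c i < l. u i * (c i - l)) \<le> (\<Sum>i\<in>I. c i * x i) - l * (\<Sum>i\<in>I. x i)" .
  have "l * s \<le> p * s"
    using \<open>l \<le> p\<close> \<open>0 \<le> s\<close> by (rule mult_right_mono)
  with * show ?thesis
    unfolding t[symmetric] by (simp add: algebra_simps)
qed

text \<open>
  The greedy plan: \<open>l\<close> is the marginal cost, cheaper facilities are used fully, those of
  cost exactly \<open>l\<close> are used in a common proportion, dearer ones not at all.
\<close>

lemma transport_cost_attained:
  fixes c u :: "'i \<Rightarrow> real"
  assumes fin: "finite I" and u: "\<And>i. i \<in> I \<Longrightarrow> 0 \<le> u i" and cp: "\<And>i. i \<in> I \<Longrightarrow> c i < p"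
    and "0 \<le> t"
  shows "\<exists>l\<in>insert p (c ` I). \<exists>x s. (\<forall>i\<in>I. 0 \<le> x i \<and> x i \<le> u i) \<and> 0 \<le> s \<and>
    (\<Sum>i\<in>I. x i) + s = t \<and>
    (\<Sum>i\<in>I. c i * x i) + p * s = l * t + (\<Sum>i | i \<in> I \<and> c i < l. u i * (c i - l))"
proof (cases "sum u I \<le> t")
  case True
  have "{i. i \<in> I \<and> c i < p} = I"
    using cp by auto
  then show ?thesis
    using u True
    by (intro bexI[of _ p] exI[of _ u] exI[of _ "t - sum u I"])
      (auto simp: algebra_simps sum_subtractf sum_distrib_left)
next
  case False
  \<comment> \<open>The marginal cost is the least cost level at which the capacity suffices.\<close>
  define L where "L = {l\<in>c ` I. t \<le> (\<Sum>i | i \<in> I \<and> c i \<le> l. u i)}"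
  have ne: "I \<noteq> {}"
    using False \<open>0 \<le> t\<close> by auto
  have "{i. i \<in> I \<and> c i \<le> Max (c ` I)} = I"
    using fin by auto
  then have "Max (c ` I) \<in> L"
    using False fin ne by (simp add: L_def)
  moreover have finL: "finite L"
    using fin by (simp add: L_def)
  ultimately have lL: "Min L \<in> L"
    by (intro Min_in) auto
  define l where "l = Min L"
  have l: "l \<in> c ` I" "t \<le> (\<Sum>i | i \<in> I \<and> c i \<le> l. u i)"
    using lL by (auto simp: L_def l_def)
  define S where "S = {i. i \<in> I \<and> c i < l}"
  define E where "E = {i. i \<in> I \<and> c i = l}"
  have finSE: "finite S" "finite E" "S \<subseteq> I" "E \<subseteq> I" "S \<inter> E = {}"
    using fin by (auto simp: S_def E_def)
  have below: "sum u S \<le> t"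
  proof (cases "S = {}")
    case True
    then show ?thesis using \<open>0 \<le> t\<close> by simp
  next
    case False
    define b where "b = Max (c ` S)"
    have "b \<in> c ` S"
      unfolding b_def using finSE False by (intro Max_in) auto
    then have b: "b \<in> c ` I" "b < l"
      by (auto simp: S_def)
    have "b \<notin> L"
      using b(2) Min_le[OF finL, of b] unfolding l_def by (meson not_le)
    moreover have "{i. i \<in> I \<and> c i \<le> b} = S"
    proof -
      have "c i \<le> b" if "i \<in> S" for i
        using that finSE by (simp add: b_def)
      then show ?thesis
        using b(2) by (auto simp: S_def)
    qed
    ultimately show ?thesis
      using b(1) by (simp add: L_def)
  qed
  have "{i. i \<in> I \<and> c i \<le> l} = S \<union> E"
    by (auto simp: S_def E_def)
  then have above: "t \<le> sum u S + sum u E"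
    using l(2) finSE by (simp add: sum.union_disjoint)
  \<comment> \<open>If \<open>sum u E = 0\<close>, then \<open>t = sum u S\<close>, and \<open>q = 0\<close> is the right proportion.\<close>
  define q where "q = (t - sum u S) / sum u E"
  have E0: "0 \<le> sum u E"
    using u finSE by (intro sum_nonneg) auto
  have q: "0 \<le> q" "q \<le> 1" "q * sum u E = t - sum u S"
    using E0 below above by (auto simp: q_def divide_simps)
  define x where "x = (\<lambda>i. if c i < l then u i else if c i = l then q * u i else 0)"
  have split: "(\<Sum>i\<in>I. f i * x i) = (\<Sum>i\<in>S. f i * u i) + (\<Sum>i\<in>E. f i * (q * u i))" for f
  proof -
    have "(\<Sum>i\<in>I. f i * x i) = (\<Sum>i\<in>S \<union> E. f i * x i)"
      using fin by (intro sum.mono_neutral_right) (auto simp: S_def E_def x_def)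
    also have "\<dots> = (\<Sum>i\<in>S. f i * x i) + (\<Sum>i\<in>E. f i * x i)"
      using finSE by (simp add: sum.union_disjoint)
    also have "\<dots> = (\<Sum>i\<in>S. f i * u i) + (\<Sum>i\<in>E. f i * (q * u i))"
      by (auto simp: S_def E_def x_def)
    finally show ?thesis .
  qed
  have bounds: "0 \<le> x i \<and> x i \<le> u i" if "i \<in> I" for i
    using u[OF that] q by (auto simp: x_def mult_left_le_one_le)
  have total: "(\<Sum>i\<in>I. x i) = t"
    using split[of "\<lambda>_. 1"] q by (simp add: sum_distrib_left[symmetric])
  have "(\<Sum>i\<in>E. c i * (q * u i)) = l * (q * sum u E)"
    by (simp add: E_def sum_distrib_left)
  then have "(\<Sum>i\<in>I. c i * x i) = (\<Sum>i\<in>S. c i * u i) + l * (t - sum u S)"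
    using split[of c] q by simp
  also have "\<dots> = l * t + (\<Sum>i\<in>S. u i * (c i - l))"
    by (simp add: algebra_simps sum_subtractf sum_distrib_left)
  finally have "(\<Sum>i\<in>I. c i * x i) = l * t + (\<Sum>i | i \<in> I \<and> c i < l. u i * (c i - l))"
    by (simp add: S_def)
  then show ?thesis
    using l(1) bounds total by (intro bexI[of _ l] exI[of _ x] exI[of _ 0]) auto
qed

section \<open>The second stage in closed form\<close>

text \<open>
  The least cost of serving demand \<open>t\<close> at site \<open>j\<close> without the revenue, as the maximum of
  the dual function over its break points and its end point \<open>penalty D j\<close>.
\<close>

definition site_value :: "'j fl_data \<Rightarrow> (nat \<Rightarrow> real) \<Rightarrow> 'j \<Rightarrow> real \<Rightarrow> real" where
  "site_value D y j t = (MAX i'\<in>insert 0 (facs D).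
     ext_cost D i' j * t +
     (\<Sum>i | i \<in> facs D \<and> ship_cost D i j < ext_cost D i' j.
        capacity D i * y i * (ship_cost D i j - ext_cost D i' j)))"

lemma finite_facs [simp]: "finite (facs D)"
  by (simp add: facs_def)

lemma zero_notin_facs [simp]: "0 \<notin> facs D"
  by (simp add: facs_def)

lemma well_formedD:
  assumes "well_formed D"
  shows "nfac D \<ge> 1" "finite (sites D)"
    and "i \<in> facs D \<Longrightarrow> j \<in> sites D \<Longrightarrow> ship_cost D i j < penalty D j"
    and "i \<in> facs D \<Longrightarrow> capacity D i \<ge> 0"
    and "k \<in> {1..nval D} \<Longrightarrow> demand D k \<ge> 0"
    and "j \<in> sites D \<Longrightarrow> mu_bar D j \<ge> 0" "j \<in> sites D \<Longrightarrow> var_bar D j \<ge> 0"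
    and "j \<in> sites D \<Longrightarrow> i \<in> facs D \<Longrightarrow> 0 \<le> lam_var D j i"
    and "j \<in> sites D \<Longrightarrow> (\<Sum>i\<in>facs D. lam_var D j i) < 1"
    and "j \<in> sites D \<Longrightarrow> eps_mu D j \<ge> 0" "j \<in> sites D \<Longrightarrow> eps_lo D j \<ge> 0"
        "j \<in> sites D \<Longrightarrow> eps_lo D j \<le> 1" "j \<in> sites D \<Longrightarrow> eps_hi D j \<ge> 1"
  using assms unfolding well_formed_def by auto

lemma decision_binary:
  assumes "well_formed D" "y \<in> decisions D" "i \<in> facs D"
  shows "y i = 0 \<or> y i = 1"
proof -
  have "y \<in> facs D \<rightarrow>\<^sub>E {0, 1}"
    using assms unfolding well_formed_def by blast
  with assms(3) show ?thesis
    by (auto dest: PiE_mem)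
qed

lemma site_value_le:
  assumes wf: "well_formed D" and j: "j \<in> sites D"
    and x: "\<And>i. i \<in> facs D \<Longrightarrow> 0 \<le> x i \<and> x i \<le> capacity D i * y i"
    and s: "0 \<le> s" "(\<Sum>i\<in>facs D. x i) + s = t"
  shows "site_value D y j t \<le> (\<Sum>i\<in>facs D. ship_cost D i j * x i) + penalty D j * s"
proof -
  have "ext_cost D i' j \<le> penalty D j" if "i' \<in> insert 0 (facs D)" for i'
    using that well_formedD(3)[OF wf _ j] by (auto simp: ext_cost_def less_imp_le)
  then show ?thesis
    unfolding site_value_def by (auto intro!: transport_cost_ge[OF finite_facs x s])
qed

lemma site_value_attained:
  assumes wf: "well_formed D" and y: "y \<in> decisions D" and j: "j \<in> sites D" and "0 \<le> t"
  shows "\<exists>x s. (\<forall>i\<in>facs D. 0 \<le> x i \<and> x i \<le> capacity D i * y i) \<and> 0 \<le> s \<and>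
    (\<Sum>i\<in>facs D. x i) + s = t \<and>
    (\<Sum>i\<in>facs D. ship_cost D i j * x i) + penalty D j * s = site_value D y j t"
proof -
  have cap: "0 \<le> capacity D i * y i" if "i \<in> facs D" for i
    using decision_binary[OF wf y that] well_formedD(4)[OF wf that] by auto
  obtain l x s where l: "l \<in> insert (penalty D j) ((\<lambda>i. ship_cost D i j) ` facs D)"
    and x: "\<forall>i\<in>facs D. 0 \<le> x i \<and> x i \<le> capacity D i * y i" "0 \<le> s" "(\<Sum>i\<in>facs D. x i) + s = t"
    and eq: "(\<Sum>i\<in>facs D. ship_cost D i j * x i) + penalty D j * s = l * t +
        (\<Sum>i | i \<in> facs D \<and> ship_cost D i j < l. capacity D i * y i * (ship_cost D i j - l))"
    using transport_cost_attained[of "facs D" "\<lambda>i. capacity D i * y i" "\<lambda>i. ship_cost D i j"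
        "penalty D j" t] cap well_formedD(3)[OF wf _ j] \<open>0 \<le> t\<close> by auto
  obtain i' where i': "i' \<in> insert 0 (facs D)" "l = ext_cost D i' j"
  proof -
    have "\<exists>i'\<in>insert 0 (facs D). l = ext_cost D i' j"
      using l by (auto simp: ext_cost_def) (metis zero_notin_facs)
    then show ?thesis using that by blast
  qed
  have "(\<Sum>i\<in>facs D. ship_cost D i j * x i) + penalty D j * s \<le> site_value D y j t"
    unfolding eq site_value_def i'(2) using i'(1) by (intro Max_ge) auto
  moreover have "site_value D y j t \<le> (\<Sum>i\<in>facs D. ship_cost D i j * x i) + penalty D j * s"
    using x by (intro site_value_le[OF wf j]) auto
  ultimately show ?thesis
    using x by (intro exI[of _ x] exI[of _ s]) auto
qed

lemma second_stage_eq: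
  assumes wf: "well_formed D" and y: "y \<in> decisions D" and dem: "\<And>j. j \<in> sites D \<Longrightarrow> 0 \<le> dem j"
  shows "second_stage D y dem = (\<Sum>j\<in>sites D. site_value D y j (dem j) - revenue D j * dem j)"
proof -
  have cost: "recourse_cost D dem x s = (\<Sum>j\<in>sites D.
      (\<Sum>i\<in>facs D. ship_cost D i j * x i j) + penalty D j * s j - revenue D j * dem j)" for x s
    unfolding recourse_cost_def
    by (subst sum.swap) (simp add: sum.distrib sum_subtractf)
  have "\<forall>j\<in>sites D. \<exists>x s. (\<forall>i\<in>facs D. 0 \<le> x i \<and> x i \<le> capacity D i * y i) \<and> 0 \<le> s \<and>
    (\<Sum>i\<in>facs D. x i) + s = dem j \<and>
    (\<Sum>i\<in>facs D. ship_cost D i j * x i) + penalty D j * s = site_value D y j (dem j)"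
    using site_value_attained[OF wf y] dem by blast
  from bchoice[OF this] obtain X where "\<forall>j\<in>sites D. \<exists>s. (\<forall>i\<in>facs D. 0 \<le> X j i \<and> X j i \<le> capacity D i * y i) \<and>
    0 \<le> s \<and> (\<Sum>i\<in>facs D. X j i) + s = dem j \<and>
    (\<Sum>i\<in>facs D. ship_cost D i j * X j i) + penalty D j * s = site_value D y j (dem j)" ..
  from bchoice[OF this] obtain S where XS: "\<forall>j\<in>sites D. (\<forall>i\<in>facs D. 0 \<le> X j i \<and> X j i \<le> capacity D i * y i) \<and>
    0 \<le> S j \<and> (\<Sum>i\<in>facs D. X j i) + S j = dem j \<and>
    (\<Sum>i\<in>facs D. ship_cost D i j * X j i) + penalty D j * S j = site_value D y j (dem j)" ..
  show ?thesis
    unfolding second_stage_def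
  proof (rule Least_equality)
    show "\<exists>x s. recourse_feasible D y dem x s \<and>
      (\<Sum>j\<in>sites D. site_value D y j (dem j) - revenue D j * dem j) = recourse_cost D dem x s"
      using XS by (intro exI[of _ "\<lambda>i j. X j i"] exI[of _ S]) (auto simp: recourse_feasible_def cost)
  next
    fix v assume "\<exists>x s. recourse_feasible D y dem x s \<and> v = recourse_cost D dem x s"
    then obtain x s where f: "recourse_feasible D y dem x s" and v: "v = recourse_cost D dem x s"
      by blast
    show "(\<Sum>j\<in>sites D. site_value D y j (dem j) - revenue D j * dem j) \<le> v"
      unfolding v cost using f
      by (intro sum_mono diff_right_mono site_value_le[OF wf]) (auto simp: recourse_feasible_def)
  qed
qed

section \<open>Expectations from marginals\<close>

text \<open>
  The values \<open>d k\<close> may coincide for different \<open>k\<close>, and the law \<open>R\<close> may have infinite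
  support; only the distribution of \<open>X\<close> is finitely supported.
\<close>

lemma expectation_of_marginal:
  fixes R :: "'a pmf" and d :: "'k \<Rightarrow> 'b" and H :: "'b \<Rightarrow> real"
  assumes fin: "finite K"
    and marg: "\<And>t. measure_pmf.prob R {w. X w = t} = (\<Sum>k | k \<in> K \<and> d k = t. p k)"
  shows "set_pmf (map_pmf X R) \<subseteq> d ` K"
    and "measure_pmf.expectation R (\<lambda>w. H (X w)) = (\<Sum>k\<in>K. p k * H (d k))"
    and "integrable (measure_pmf R) (\<lambda>w. H (X w))"
proof -
  have pmf: "pmf (map_pmf X R) t = (\<Sum>k | k \<in> K \<and> d k = t. p k)" for t
    using marg[of t] by (simp add: pmf_map vimage_def)
  show sub: "set_pmf (map_pmf X R) \<subseteq> d ` K"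
  proof
    fix t assume "t \<in> set_pmf (map_pmf X R)"
    then have "(\<Sum>k | k \<in> K \<and> d k = t. p k) \<noteq> 0"
      unfolding set_pmf_iff pmf .
    then have "{k. k \<in> K \<and> d k = t} \<noteq> {}"
      by (metis sum.empty)
    then show "t \<in> d ` K" by auto
  qed
  have finR: "finite (set_pmf (map_pmf X R))"
    using sub fin finite_surj by blast
  have "measure_pmf.expectation R (\<lambda>w. H (X w)) = measure_pmf.expectation (map_pmf X R) H"
    by simp
  also have "\<dots> = (\<Sum>t\<in>d ` K. pmf (map_pmf X R) t *\<^sub>R H t)"
    using fin sub by (intro integral_measure_pmf) auto
  also have "\<dots> = (\<Sum>t\<in>d ` K. \<Sum>k | k \<in> K \<and> d k = t. p k * H (d k))"
    by (simp add: pmf sum_distrib_right)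
  also have "\<dots> = (\<Sum>k\<in>K. p k * H (d k))"
    using sum.image_gen[OF fin, of "\<lambda>k. p k * H (d k)" d] by simp
  finally show "measure_pmf.expectation R (\<lambda>w. H (X w)) = (\<Sum>k\<in>K. p k * H (d k))" .
  have "integrable (measure_pmf (map_pmf X R)) H"
    using finR by (rule integrable_measure_pmf_finite)
  then show "integrable (measure_pmf R) (\<lambda>w. H (X w))"
    by simp
qed

lemma expected_cost_eq:
  assumes wf: "well_formed D" and y: "y \<in> decisions D" and marg: "has_marginals D \<pi> (Q y \<pi>)"
  shows "expected_cost D Q y \<pi> = (\<Sum>j\<in>sites D. \<Sum>k\<in>{1..nval D}.
           \<pi> j k * (site_value D y j (demand D k) - revenue D j * demand D k))"
proof -
  define H where "H j t = site_value D y j t - revenue D j * t" for j t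
  have m: "measure_pmf.prob (Q y \<pi>) {dem. dem j = t} = (\<Sum>k | k \<in> {1..nval D} \<and> demand D k = t. \<pi> j k)"
    if "j \<in> sites D" for j t
    using marg that unfolding has_marginals_def by blast
  note marginal = expectation_of_marginal[OF finite_atLeastAtMost m]
  have "second_stage D y dem = (\<Sum>j\<in>sites D. H j (dem j))" if "dem \<in> set_pmf (Q y \<pi>)" for dem
    unfolding H_def
  proof (rule second_stage_eq[OF wf y])
    fix j assume "j \<in> sites D"
    then have "dem j \<in> demand D ` {1..nval D}"
      using marginal(1)[of j] that by auto
    then show "0 \<le> dem j"
      using well_formedD(5)[OF wf] by auto
  qed
  then have "expected_cost D Q y \<pi>
      = measure_pmf.expectation (Q y \<pi>) (\<lambda>dem. \<Sum>j\<in>sites D. H j (dem j))"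
    unfolding expected_cost_def by (intro integral_cong_AE) (auto simp: AE_measure_pmf_iff)
  also have "\<dots> = (\<Sum>j\<in>sites D. measure_pmf.expectation (Q y \<pi>) (\<lambda>dem. H j (dem j)))"
    using marginal(3) by (intro Bochner_Integration.integral_sum) auto
  also have "\<dots> = (\<Sum>j\<in>sites D. \<Sum>k\<in>{1..nval D}. \<pi> j k * H j (demand D k))"
    using marginal(2) by (intro sum.cong) auto
  finally show ?thesis
    by (simp add: H_def)
qed

section \<open>Linear programming duality for two moment constraints\<close>

text \<open>
  The map \<open>P\<close> need not be injective, so the weights are put on one index for each point.
\<close>

lemma convex_hull_finite_image:
  fixes P :: "'k \<Rightarrow> 'a::real_vector"
  assumes "finite K" and "z \<in> convex hull (P ` K)"
  obtains p where "\<forall>k\<in>K. 0 \<le> p k" "sum p K = 1" "z = (\<Sum>k\<in>K. p k *\<^sub>R P k)"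
proof -
  obtain K' where K': "K' \<subseteq> K" "inj_on P K'" "P ` K = P ` K'"
    using subset_image_inj[of "P ` K" P K] by auto
  have "finite K'"
    using K'(1) \<open>finite K\<close> finite_subset by blast
  obtain u where u: "\<And>x. x \<in> P ` K' \<Longrightarrow> 0 \<le> u x" "sum u (P ` K') = 1"
      "z = (\<Sum>x\<in>P ` K'. u x *\<^sub>R x)"
    using assms(2) \<open>finite K'\<close> unfolding K'(3) by (auto simp: convex_hull_finite)
  define p where "p k = (if k \<in> K' then u (P k) else 0)" for k
  have "sum p K = sum p K'"
    using K'(1) \<open>finite K\<close> by (intro sum.mono_neutral_right) (auto simp: p_def)
  also have "\<dots> = 1"
    using u(2) K'(2) by (simp add: sum.reindex p_def)
  finally have "sum p K = 1" .
  moreover have "(\<Sum>k\<in>K. p k *\<^sub>R P k) = (\<Sum>k\<in>K'. p k *\<^sub>R P k)"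
    using K'(1) \<open>finite K\<close> by (intro sum.mono_neutral_right) (auto simp: p_def)
  then have "z = (\<Sum>k\<in>K. p k *\<^sub>R P k)"
    using u(3) K'(2) by (simp add: sum.reindex p_def)
  ultimately show thesis
    using u(1) by (intro that[of p]) (auto simp: p_def)
qed

text \<open>
  The moments of \<open>d\<close> and \<open>e\<close> are confined to \<open>[ml, mh]\<close> and \<open>[ql, qh]\<close>.  The multipliers
  \<open>a1\<close>, \<open>a2\<close> belong to the upper and the lower bound on the moment of \<open>d\<close>, likewise \<open>b1\<close>,
  \<open>b2\<close> for \<open>e\<close>, and \<open>a\<close> to the normalization of \<open>p\<close>.
\<close>

lemma moment_weak_duality:
  fixes g d e p :: "'k \<Rightarrow> real"
  assumes p: "\<And>k. k \<in> K \<Longrightarrow> 0 \<le> p k" "sum p K = 1"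
    and box: "ml \<le> (\<Sum>k\<in>K. p k * d k)" "(\<Sum>k\<in>K. p k * d k) \<le> mh"
      "ql \<le> (\<Sum>k\<in>K. p k * e k)" "(\<Sum>k\<in>K. p k * e k) \<le> qh"
    and nonneg: "0 \<le> a1" "0 \<le> a2" "0 \<le> b1" "0 \<le> b2"
    and feas: "\<And>k. k \<in> K \<Longrightarrow> g k \<le> a + (a1 - a2) * d k + (b1 - b2) * e k"
  shows "(\<Sum>k\<in>K. p k * g k) \<le> a + a1 * mh - a2 * ml + b1 * qh - b2 * ql"
proof -
  have "(\<Sum>k\<in>K. p k * g k) \<le> (\<Sum>k\<in>K. p k * (a + (a1 - a2) * d k + (b1 - b2) * e k))"
    using p feas by (intro sum_mono mult_left_mono) auto
  also have "\<dots> = (\<Sum>k\<in>K. a * p k + (a1 - a2) * (p k * d k) + (b1 - b2) * (p k * e k))"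
    by (intro sum.cong) (auto simp: algebra_simps)
  also have "\<dots> = a * sum p K + (a1 - a2) * (\<Sum>k\<in>K. p k * d k) + (b1 - b2) * (\<Sum>k\<in>K. p k * e k)"
    unfolding sum.distrib sum_distrib_left ..
  also have "\<dots> = a + (a1 - a2) * (\<Sum>k\<in>K. p k * d k) + (b1 - b2) * (\<Sum>k\<in>K. p k * e k)"
    by (simp add: p)
  also have "\<dots> \<le> a + a1 * mh - a2 * ml + b1 * qh - b2 * ql"
    using mult_left_mono[OF box(1) nonneg(2)] mult_left_mono[OF box(2) nonneg(1)]
      mult_left_mono[OF box(3) nonneg(4)] mult_left_mono[OF box(4) nonneg(3)]
    by (simp add: algebra_simps)
  finally show ?thesis .
qed

text \<open>
  An optimal solution of the dual program yields a distribution of the same value; in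
  particular, the primal program is feasible and \<open>K\<close> is nonempty.
\<close>

lemma moment_strong_duality:
  fixes g d e :: "'k \<Rightarrow> real"
  assumes fin: "finite K" and box: "ml \<le> mh" "ql \<le> qh"
    and nonneg: "0 \<le> a1" "0 \<le> a2" "0 \<le> b1" "0 \<le> b2"
    and feas: "\<And>k. k \<in> K \<Longrightarrow> g k \<le> a + (a1 - a2) * d k + (b1 - b2) * e k"
    and V: "V = a + a1 * mh - a2 * ml + b1 * qh - b2 * ql"
    and opt: "\<And>a a1 a2 b1 b2. 0 \<le> a1 \<Longrightarrow> 0 \<le> a2 \<Longrightarrow> 0 \<le> b1 \<Longrightarrow> 0 \<le> b2 \<Longrightarrow>
      (\<And>k. k \<in> K \<Longrightarrow> g k \<le> a + (a1 - a2) * d k + (b1 - b2) * e k) \<Longrightarrow>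
      V \<le> a + a1 * mh - a2 * ml + b1 * qh - b2 * ql"
  shows "\<exists>p. (\<forall>k\<in>K. 0 \<le> p k) \<and> sum p K = 1 \<and>
    ml \<le> (\<Sum>k\<in>K. p k * d k) \<and> (\<Sum>k\<in>K. p k * d k) \<le> mh \<and>
    ql \<le> (\<Sum>k\<in>K. p k * e k) \<and> (\<Sum>k\<in>K. p k * e k) \<le> qh \<and>
    (\<Sum>k\<in>K. p k * g k) = V"
proof -
  define T where "T = convex hull ((\<lambda>k. (d k, e k, g k)) ` K)"
  define R where "R = {ml..mh} \<times> {ql..qh} \<times> {V..}"
  have "T \<inter> R \<noteq> {}"
  proof
    assume disj: "T \<inter> R = {}"
    \<comment> \<open>Without constraints, the free multiplier \<open>a\<close> could be lowered below \<open>V\<close>.\<close>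
    have "K \<noteq> {}"
      using opt[of 0 0 0 0 "V - 1"] by auto
    then have "T \<noteq> {}" by (simp add: T_def)
    have "compact T"
      unfolding T_def using fin by (simp add: finite_imp_compact_convex_hull)
    moreover have "convex R" "closed R"
      unfolding R_def by (intro convex_Times closed_Times; simp)+
    ultimately obtain n \<beta> where lt: "\<forall>z\<in>T. n \<bullet> z < \<beta>" and gt: "\<forall>z\<in>R. n \<bullet> z > \<beta>"
      using separating_hyperplane_compact_closed[of T R] \<open>T \<noteq> {}\<close> disj
      by (auto simp: T_def)
    obtain u v w where n: "n = (u, v, w)"
      by (metis surj_pair)
    have K: "u * d k + v * e k + w * g k < \<beta>" if "k \<in> K" for k
    proof -
      have "(d k, e k, g k) \<in> T"
        unfolding T_def using that by (intro hull_inc) auto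
      then show ?thesis
        using lt by (auto simp: n)
    qed
    have Rgt: "\<beta> < u * m + v * q + w * r" if "ml \<le> m" "m \<le> mh" "ql \<le> q" "q \<le> qh" "V \<le> r" for m q r
    proof -
      have "(m, q, r) \<in> R" using that by (simp add: R_def)
      then show ?thesis using gt by (auto simp: n)
    qed
    \<comment> \<open>Otherwise the functional would be unbounded below on \<open>R\<close>, which extends upwards.\<close>
    have w: "0 \<le> w"
    proof (rule ccontr)
      assume "\<not> 0 \<le> w"
      define r where "r = max V ((\<beta> - u * ml - v * ql) / w)"
      have "w * r \<le> w * ((\<beta> - u * ml - v * ql) / w)"
        using \<open>\<not> 0 \<le> w\<close> by (intro mult_left_mono_neg) (auto simp: r_def)
      then show False
        using Rgt[of ml ql r] box \<open>\<not> 0 \<le> w\<close> by (simp add: r_def)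
    qed
    \<comment> \<open>The point \<open>(m, q)\<close> minimizes \<open>(u, v)\<close> over the box.  The multipliers are the positive
      and negative parts of \<open>- u\<close> and \<open>- v\<close>, so that their dual value is minus this minimum.\<close>
    define m where "m = (if 0 \<le> u then ml else mh)"
    define q where "q = (if 0 \<le> v then ql else qh)"
    define u1 where "u1 = max 0 (- u)"
    define u2 where "u2 = max 0 u"
    define v1 where "v1 = max 0 (- v)"
    define v2 where "v2 = max 0 v"
    have uv: "0 \<le> u1" "0 \<le> u2" "0 \<le> v1" "0 \<le> v2" "u1 - u2 = - u" "v1 - v2 = - v"
      by (auto simp: u1_def u2_def v1_def v2_def)
    have mq: "u1 * mh - u2 * ml = - (u * m)" "v1 * qh - v2 * ql = - (v * q)"
      by (auto simp: u1_def u2_def v1_def v2_def m_def q_def)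
    have key: "\<beta> < u * m + v * q + w * V"
      using box by (intro Rgt) (auto simp: m_def q_def)
    show False
    proof (cases "w = 0")
      case True
      \<comment> \<open>The separating functional does not involve \<open>g\<close>: it is a feasible direction along which
        the dual optimum would improve.\<close>
      have "V \<le> (a + \<beta>) + (a1 + u1) * mh - (a2 + u2) * ml + (b1 + v1) * qh - (b2 + v2) * ql"
      proof (rule opt)
        fix k assume "k \<in> K"
        have shift: "a1 + u1 - (a2 + u2) = a1 - a2 - u" "b1 + v1 - (b2 + v2) = b1 - b2 - v"
          using uv by linarith+
        show "g k \<le> a + \<beta> + (a1 + u1 - (a2 + u2)) * d k + (b1 + v1 - (b2 + v2)) * e k"
          unfolding shift using feas[OF \<open>k \<in> K\<close>] K[OF \<open>k \<in> K\<close>] True by (simp add: algebra_simps)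
      qed (use nonneg uv in auto)
      then show False
        using key mq True V by (simp add: algebra_simps)
    next
      case False
      then have "0 < w" using w by simp
      \<comment> \<open>Scaled to last coordinate \<open>1\<close>, the functional is itself dual feasible.\<close>
      have "V \<le> \<beta> / w + u1 / w * mh - u2 / w * ml + v1 / w * qh - v2 / w * ql"
      proof (rule opt)
        fix k assume "k \<in> K"
        have "u1 / w - u2 / w = - u / w" "v1 / w - v2 / w = - v / w"
          unfolding diff_divide_distrib[symmetric] uv by simp_all
        moreover have "g k \<le> (\<beta> - u * d k - v * e k) / w"
          using K[OF \<open>k \<in> K\<close>] \<open>0 < w\<close> by (simp add: field_simps)
        ultimately show "g k \<le> \<beta> / w + (u1 / w - u2 / w) * d k + (v1 / w - v2 / w) * e k"
          by (simp add: diff_divide_distrib)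
      qed (use uv \<open>0 < w\<close> in auto)
      also have "\<dots> = (\<beta> + (u1 * mh - u2 * ml) + (v1 * qh - v2 * ql)) / w"
        by (simp add: add_divide_distrib diff_divide_distrib)
      also have "\<dots> < V"
        using key \<open>0 < w\<close> unfolding mq by (simp add: field_simps)
      finally show False by simp
    qed
  qed
  then obtain z where z: "z \<in> T" "z \<in> R" by auto
  obtain p where p: "\<forall>k\<in>K. 0 \<le> p k" "sum p K = 1" "z = (\<Sum>k\<in>K. p k *\<^sub>R (d k, e k, g k))"
    using convex_hull_finite_image[OF fin z(1)[unfolded T_def]] .
  have "z = (\<Sum>k\<in>K. p k * d k, \<Sum>k\<in>K. p k * e k, \<Sum>k\<in>K. p k * g k)"
    unfolding p(3) by (simp add: sum_prod)
  then have m: "ml \<le> (\<Sum>k\<in>K. p k * d k)" "(\<Sum>k\<in>K. p k * d k) \<le> mh"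
      "ql \<le> (\<Sum>k\<in>K. p k * e k)" "(\<Sum>k\<in>K. p k * e k) \<le> qh" "V \<le> (\<Sum>k\<in>K. p k * g k)"
    using z(2) by (auto simp: R_def)
  have "(\<Sum>k\<in>K. p k * g k) \<le> V"
    unfolding V using bspec[OF p(1)] p(2) m(1-4) nonneg feas by (rule moment_weak_duality)
  then show ?thesis
    using p m by (intro exI[of _ p]) auto
qed

section \<open>The worst-case expectation equals the dual optimum\<close>

lemma dual_feasible_iff:
  "dual_feasible D y v \<longleftrightarrow>
     (\<forall>h\<in>{1, 2}. \<forall>j\<in>sites D. v_delta v h j \<ge> 0 \<and> v_gamma v h j \<ge> 0) \<and>
     (\<forall>j\<in>sites D. \<forall>k\<in>{1..nval D}. site_value D y j (demand D k) - revenue D j * demand D k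
        \<le> v_alpha v j + (v_delta v 1 j - v_delta v 2 j) * demand D k
          + (v_gamma v 1 j - v_gamma v 2 j) * (demand D k)\<^sup>2)"
  unfolding dual_feasible_def site_value_def ..

lemma second_moment_nonneg:
  assumes wf: "well_formed D" and y: "y \<in> decisions D" and j: "j \<in> sites D"
  shows "0 \<le> var_fn D y j + (mean_fn D y j)\<^sup>2"
proof -
  have "(\<Sum>i\<in>facs D. lam_var D j i * y i) \<le> (\<Sum>i\<in>facs D. lam_var D j i)"
    using decision_binary[OF wf y] well_formedD(8)[OF wf j] by (intro sum_mono) force
  then have "0 \<le> var_fn D y j"
    unfolding var_fn_def using well_formedD(7,9)[OF wf j] by (intro mult_nonneg_nonneg) auto
  then show ?thesis by simp
qed

text \<open>
  The dual program is a sum over sites, so a joint optimum is optimal at every site: changing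
  the multipliers at one site only cannot improve it.
\<close>

lemma dual_optimal_at_site:
  fixes v :: "'j dual_vars"
  assumes fin: "finite (sites D)" and j: "j \<in> sites D" and v: "dual_feasible D y v"
    and opt: "\<And>v'. dual_feasible D y v' \<Longrightarrow> dual_objective D y v \<le> dual_objective D y v'"
    and nonneg: "0 \<le> a1" "0 \<le> a2" "0 \<le> b1" "0 \<le> b2"
    and feas: "\<And>k. k \<in> {1..nval D} \<Longrightarrow> site_value D y j (demand D k) - revenue D j * demand D k
        \<le> a + (a1 - a2) * demand D k + (b1 - b2) * (demand D k)\<^sup>2"
  defines "M \<equiv> var_fn D y j + (mean_fn D y j)\<^sup>2"
  shows "v_alpha v j + v_delta v 1 j * (mean_fn D y j + eps_mu D j)
        - v_delta v 2 j * (mean_fn D y j - eps_mu D j)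
        + v_gamma v 1 j * (M * eps_hi D j) - v_gamma v 2 j * (M * eps_lo D j)
     \<le> a + a1 * (mean_fn D y j + eps_mu D j) - a2 * (mean_fn D y j - eps_mu D j)
        + b1 * (M * eps_hi D j) - b2 * (M * eps_lo D j)"
proof -
  define v' :: "'j dual_vars" where "v' =
    \<lparr>v_alpha = (v_alpha v)(j := a),
     v_delta = (\<lambda>h. (v_delta v h)(j := if h = 1 then a1 else a2)),
     v_gamma = (\<lambda>h. (v_gamma v h)(j := if h = 1 then b1 else b2))\<rparr>"
  have "dual_feasible D y v'"
    using v nonneg feas unfolding dual_feasible_iff by (auto simp: v'_def)
  then have "dual_objective D y v \<le> dual_objective D y v'"
    by (rule opt)
  then show ?thesis
    unfolding dual_objective_def sum.remove[OF fin j] M_def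
    by (simp add: v'_def mult.assoc)
qed

lemma worst_case_eq_dual:
  fixes v :: "'j dual_vars"
  assumes wf: "well_formed D" and y: "y \<in> decisions D" and v: "dual_feasible D y v"
    and opt: "\<And>v'. dual_feasible D y v' \<Longrightarrow> dual_objective D y v \<le> dual_objective D y v'"
    and Q: "\<And>\<pi>. \<pi> \<in> ambiguity_set D y \<Longrightarrow> has_marginals D \<pi> (Q y \<pi>)"
  shows "\<And>\<pi>. \<pi> \<in> ambiguity_set D y \<Longrightarrow> expected_cost D Q y \<pi> \<le> dual_objective D y v"
    and "\<exists>\<pi>\<in>ambiguity_set D y. expected_cost D Q y \<pi> = dual_objective D y v"
proof -
  define K where "K = {1..nval D}"
  define ml where "ml j = mean_fn D y j - eps_mu D j" for j
  define mh where "mh j = mean_fn D y j + eps_mu D j" for j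
  define ql where "ql j = (var_fn D y j + (mean_fn D y j)\<^sup>2) * eps_lo D j" for j
  define qh where "qh j = (var_fn D y j + (mean_fn D y j)\<^sup>2) * eps_hi D j" for j
  define g where "g j k = site_value D y j (demand D k) - revenue D j * demand D k" for j k
  have amb: "\<pi> \<in> ambiguity_set D y \<longleftrightarrow> (\<forall>j\<in>sites D. (\<forall>k\<in>K. 0 \<le> \<pi> j k) \<and> sum (\<pi> j) K = 1 \<and>
      ml j \<le> (\<Sum>k\<in>K. \<pi> j k * demand D k) \<and> (\<Sum>k\<in>K. \<pi> j k * demand D k) \<le> mh j \<and>
      ql j \<le> (\<Sum>k\<in>K. \<pi> j k * (demand D k)\<^sup>2) \<and> (\<Sum>k\<in>K. \<pi> j k * (demand D k)\<^sup>2) \<le> qh j)" for \<pi>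
    unfolding ambiguity_set_def K_def ml_def mh_def ql_def qh_def abs_le_iff
    by (auto simp: algebra_simps)
  define V where "V j = v_alpha v j + v_delta v 1 j * mh j - v_delta v 2 j * ml j
      + v_gamma v 1 j * qh j - v_gamma v 2 j * ql j" for j
  have dual: "dual_objective D y v = (\<Sum>j\<in>sites D. V j)"
    unfolding dual_objective_def V_def ml_def mh_def ql_def qh_def by (simp add: mult.assoc)
  have cost: "expected_cost D Q y \<pi> = (\<Sum>j\<in>sites D. \<Sum>k\<in>K. \<pi> j k * g j k)"
    if "\<pi> \<in> ambiguity_set D y" for \<pi>
    unfolding K_def g_def by (rule expected_cost_eq[where Q = Q, OF wf y Q[OF that]])
  have nonneg: "0 \<le> v_delta v 1 j" "0 \<le> v_delta v 2 j" "0 \<le> v_gamma v 1 j" "0 \<le> v_gamma v 2 j"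
    if "j \<in> sites D" for j
    using v that unfolding dual_feasible_iff by auto
  have feas: "g j k \<le> v_alpha v j + (v_delta v 1 j - v_delta v 2 j) * demand D k
      + (v_gamma v 1 j - v_gamma v 2 j) * (demand D k)\<^sup>2" if "j \<in> sites D" "k \<in> K" for j k
    using v that unfolding dual_feasible_iff g_def K_def by blast
  show "expected_cost D Q y \<pi> \<le> dual_objective D y v" if \<pi>: "\<pi> \<in> ambiguity_set D y" for \<pi>
    unfolding cost[OF \<pi>] dual
  proof (rule sum_mono)
    fix j assume j: "j \<in> sites D"
    show "(\<Sum>k\<in>K. \<pi> j k * g j k) \<le> V j"
      unfolding V_def using \<pi>[unfolded amb] j nonneg[OF j] feas[OF j]
      by (intro moment_weak_duality[where d = "demand D" and e = "\<lambda>k. (demand D k)\<^sup>2"]) auto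
  qed
  have "\<exists>p. (\<forall>k\<in>K. 0 \<le> p k) \<and> sum p K = 1 \<and>
      ml j \<le> (\<Sum>k\<in>K. p k * demand D k) \<and> (\<Sum>k\<in>K. p k * demand D k) \<le> mh j \<and>
      ql j \<le> (\<Sum>k\<in>K. p k * (demand D k)\<^sup>2) \<and> (\<Sum>k\<in>K. p k * (demand D k)\<^sup>2) \<le> qh j \<and>
      (\<Sum>k\<in>K. p k * g j k) = V j" (is "?P j") if j: "j \<in> sites D" for j
  proof (rule moment_strong_duality[OF _ _ _ nonneg[OF j] feas[OF j] V_def])
    show "finite K" by (simp add: K_def)
    show "ml j \<le> mh j"
      using well_formedD(10)[OF wf j] by (simp add: ml_def mh_def)
    show "ql j \<le> qh j"
      unfolding ql_def qh_def using second_moment_nonneg[OF wf y j] well_formedD(12,13)[OF wf j]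
      by (intro mult_left_mono) auto
    show "V j \<le> a + a1 * mh j - a2 * ml j + b1 * qh j - b2 * ql j"
      if "0 \<le> a1" "0 \<le> a2" "0 \<le> b1" "0 \<le> b2"
        "\<And>k. k \<in> K \<Longrightarrow> g j k \<le> a + (a1 - a2) * demand D k + (b1 - b2) * (demand D k)\<^sup>2"
      for a a1 a2 b1 b2
      unfolding V_def ml_def mh_def ql_def qh_def
      by (rule dual_optimal_at_site[OF well_formedD(2)[OF wf] j v opt that(1-4)])
        (use that(5) in \<open>auto simp: g_def K_def\<close>)
  qed
  then have "\<forall>j\<in>sites D. ?P j"
    by blast
  from bchoice[OF this] obtain \<pi> where \<pi>: "\<forall>j\<in>sites D. (\<forall>k\<in>K. 0 \<le> \<pi> j k) \<and> sum (\<pi> j) K = 1 \<and>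
      ml j \<le> (\<Sum>k\<in>K. \<pi> j k * demand D k) \<and> (\<Sum>k\<in>K. \<pi> j k * demand D k) \<le> mh j \<and>
      ql j \<le> (\<Sum>k\<in>K. \<pi> j k * (demand D k)\<^sup>2) \<and> (\<Sum>k\<in>K. \<pi> j k * (demand D k)\<^sup>2) \<le> qh j \<and>
      (\<Sum>k\<in>K. \<pi> j k * g j k) = V j" ..
  then have "\<pi> \<in> ambiguity_set D y"
    unfolding amb by blast
  moreover from this have "expected_cost D Q y \<pi> = dual_objective D y v"
    unfolding cost[OF \<open>\<pi> \<in> ambiguity_set D y\<close>] dual using \<pi> by (intro sum.cong) auto
  ultimately show "\<exists>\<pi>\<in>ambiguity_set D y. expected_cost D Q y \<pi> = dual_objective D y v"
    by blast
qed

section \<open>Exact linearization at binary decisions\<close>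

lemma mccormick2_binary:
  assumes "z = 0 \<or> z = 1"
  shows "(w, \<eta>, z) \<in> mccormick2 u \<longleftrightarrow> w = \<eta> * z \<and> 0 \<le> \<eta> \<and> \<eta> \<le> u"
  using assms unfolding mccormick2_def by auto

lemma mccormick3_binary:
  assumes "z1 = 0 \<or> z1 = 1" "z2 = 0 \<or> z2 = 1"
  shows "(w, \<eta>, z1, z2) \<in> mccormick3 u \<longleftrightarrow> w = \<eta> * (z1 * z2) \<and> 0 \<le> \<eta> \<and> \<eta> \<le> u"
  using assms unfolding mccormick3_def by auto

lemma square_sum_ordered:
  fixes a :: "nat \<Rightarrow> real"
  shows "(\<Sum>l = 1..n. a l)\<^sup>2 = (\<Sum>l = 1..n. (a l)\<^sup>2) + 2 * (\<Sum>l = 1..n. \<Sum>m = 1..<l. a l * a m)"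
proof (induction n)
  case (Suc n)
  have "{1..<Suc n} = {1..n}" by auto
  then show ?case
    using Suc by (simp add: power2_sum sum_distrib_left algebra_simps)
qed simp

lemma second_moment_expansion:
  assumes wf: "well_formed D" and y: "y \<in> decisions D"
  shows "var_fn D y j + (mean_fn D y j)\<^sup>2 = (var_bar D j + (mu_bar D j)\<^sup>2)
    + (\<Sum>i\<in>facs D. lam_big D j i * y i)
    + 2 * (mu_bar D j)\<^sup>2 * (\<Sum>l = 1..nfac D. \<Sum>m = 1..<l. lam_mu D j l * lam_mu D j m * (y l * y m))"
    (is "_ = _ + ?L + 2 * _ * ?C")
proof -
  define S where "S = (\<Sum>i\<in>facs D. lam_mu D j i * y i)"
  define T where "T = (\<Sum>i\<in>facs D. (lam_mu D j i)\<^sup>2 * y i)"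
  define W where "W = (\<Sum>i\<in>facs D. lam_var D j i * y i)"
  have "S\<^sup>2 = (\<Sum>i\<in>facs D. (lam_mu D j i * y i)\<^sup>2) + 2 * ?C"
    unfolding S_def facs_def square_sum_ordered by (simp add: mult_ac)
  also have "(\<Sum>i\<in>facs D. (lam_mu D j i * y i)\<^sup>2) = T"
    unfolding T_def using decision_binary[OF wf y] by (intro sum.cong) (force simp: power_mult_distrib)+
  finally have S2: "S\<^sup>2 = T + 2 * ?C" .
  have "?L = - var_bar D j * W + (mu_bar D j)\<^sup>2 * (2 * S + T)"
    unfolding S_def T_def W_def lam_big_def
    by (simp add: sum_distrib_left sum.distrib[symmetric] algebra_simps sum_subtractf[symmetric])
  moreover have "(mean_fn D y j)\<^sup>2 = (mu_bar D j)\<^sup>2 * (1 + 2 * S + (T + 2 * ?C))"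
    unfolding mean_fn_def S_def[symmetric] S2[symmetric] by (simp add: power2_eq_square algebra_simps)
  moreover have "var_fn D y j = var_bar D j * (1 - W)"
    by (simp add: var_fn_def W_def)
  ultimately show ?thesis
    by (simp add: algebra_simps)
qed

text \<open>
  The auxiliary variables are the products that they stand for.  Only indices that occur in the
  program are constrained, for \<open>v_Psi\<close> the pairs with \<open>m < l\<close>.
\<close>

definition products_exact :: "'j fl_data \<Rightarrow> (nat \<Rightarrow> real) \<Rightarrow> 'j milp_vars \<Rightarrow> bool" where
  "products_exact D y v \<longleftrightarrow> (\<forall>h\<in>{1, 2}. \<forall>j\<in>sites D.
     (\<forall>i\<in>facs D. v_Delta v h j i = v_delta v h j * y i \<and> v_Gamma v h j i = v_gamma v h j * y i) \<and>
     (\<forall>l\<in>facs D. \<forall>m\<in>facs D. m < l \<longrightarrow> v_Psi v h j l m = v_gamma v h j * (y l * y m)))"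

lemma dual_truncate_simps [simp]:
  "v_alpha (dual_vars.truncate v) = v_alpha v"
  "v_delta (dual_vars.truncate v) = v_delta v"
  "v_gamma (dual_vars.truncate v) = v_gamma v"
  by (simp_all add: dual_vars.truncate_def)

text \<open>
  The upper bounds on the multipliers are implied by the McCormick inequalities because there
  is at least one facility.
\<close>

lemma milp_feasible_iff:
  assumes wf: "well_formed D" and y: "y \<in> decisions D"
  shows "milp_feasible D B y v \<longleftrightarrow>
    dual_feasible D y (dual_vars.truncate v) \<and> products_exact D y v \<and>
    (\<forall>h\<in>{1, 2}. \<forall>j\<in>sites D. v_delta v h j \<le> ub_delta B h j \<and> v_gamma v h j \<le> ub_gamma B h j)"
proof -
  note bin = decision_binary[OF wf y]
  have "facs D \<noteq> {}"
    using well_formedD(1)[OF wf] by (auto simp: facs_def)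
  define F where "F i' j t = ext_cost D i' j * t +
     (\<Sum>i | i \<in> facs D \<and> ship_cost D i j < ext_cost D i' j.
        capacity D i * y i * (ship_cost D i j - ext_cost D i' j))" for i' j t
  have max: "site_value D y j t - revenue D j * t \<le> r \<longleftrightarrow>
      (\<forall>i'\<in>insert 0 (facs D). (ext_cost D i' j - revenue D j) * t +
          (\<Sum>i | i \<in> facs D \<and> ship_cost D i j < ext_cost D i' j.
             capacity D i * y i * (ship_cost D i j - ext_cost D i' j)) \<le> r)" for j t r
  proof -
    have "site_value D y j t - revenue D j * t \<le> r \<longleftrightarrow> (MAX i'\<in>insert 0 (facs D). F i' j t) \<le> r + revenue D j * t"
      unfolding site_value_def F_def by linarith
    also have "\<dots> \<longleftrightarrow> (\<forall>i'\<in>insert 0 (facs D). F i' j t \<le> r + revenue D j * t)"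
      by (subst Max_le_iff) auto
    also have "\<dots> \<longleftrightarrow> (\<forall>i'\<in>insert 0 (facs D). (ext_cost D i' j - revenue D j) * t +
          (\<Sum>i | i \<in> facs D \<and> ship_cost D i j < ext_cost D i' j.
             capacity D i * y i * (ship_cost D i j - ext_cost D i' j)) \<le> r)"
      unfolding F_def by (intro ball_cong refl) (simp only: left_diff_distrib, linarith)
    finally show ?thesis .
  qed
  have mc2: "(\<forall>h\<in>{1, 2}. \<forall>j\<in>sites D. \<forall>i\<in>facs D.
        (v_Delta v h j i, v_delta v h j, y i) \<in> mccormick2 (ub_delta B h j) \<and>
        (v_Gamma v h j i, v_gamma v h j, y i) \<in> mccormick2 (ub_gamma B h j)) \<longleftrightarrow>
     (\<forall>h\<in>{1, 2}. \<forall>j\<in>sites D. \<forall>i\<in>facs D.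
        (v_Delta v h j i = v_delta v h j * y i \<and> 0 \<le> v_delta v h j \<and> v_delta v h j \<le> ub_delta B h j) \<and>
        (v_Gamma v h j i = v_gamma v h j * y i \<and> 0 \<le> v_gamma v h j \<and> v_gamma v h j \<le> ub_gamma B h j))"
    by (intro ball_cong refl) (simp add: mccormick2_binary bin)
  have mc3: "(\<forall>h\<in>{1, 2}. \<forall>j\<in>sites D. \<forall>l\<in>facs D. \<forall>m\<in>facs D. m < l \<longrightarrow>
        (v_Psi v h j l m, v_gamma v h j, y l, y m) \<in> mccormick3 (ub_gamma B h j)) \<longleftrightarrow>
     (\<forall>h\<in>{1, 2}. \<forall>j\<in>sites D. \<forall>l\<in>facs D. \<forall>m\<in>facs D. m < l \<longrightarrow>
        v_Psi v h j l m = v_gamma v h j * (y l * y m) \<and> 0 \<le> v_gamma v h j \<and> v_gamma v h j \<le> ub_gamma B h j)"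
    by (intro ball_cong refl) (simp add: mccormick3_binary bin)
  show ?thesis
    unfolding milp_feasible_def dual_feasible_iff max mc2 mc3 products_exact_def dual_truncate_simps
    using y \<open>facs D \<noteq> {}\<close> by blast
qed

lemma milp_objective_eq:
  assumes wf: "well_formed D" and y: "y \<in> decisions D" and v: "products_exact D y v"
  shows "milp_objective D y v
    = (\<Sum>i\<in>facs D. open_cost D i * y i) + dual_objective D y (dual_vars.truncate v)"
proof -
  have "v_alpha v j
        + v_delta v 1 j * (mu_bar D j + eps_mu D j)
        - v_delta v 2 j * (mu_bar D j - eps_mu D j)
        + mu_bar D j * (\<Sum>i\<in>facs D. lam_mu D j i * (v_Delta v 1 j i - v_Delta v 2 j i))
        + (var_bar D j + (mu_bar D j)\<^sup>2)
            * (eps_hi D j * v_gamma v 1 j - eps_lo D j * v_gamma v 2 j)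
        + (\<Sum>i\<in>facs D. lam_big D j i
            * (eps_hi D j * v_Gamma v 1 j i - eps_lo D j * v_Gamma v 2 j i))
        + 2 * (mu_bar D j)\<^sup>2 * (\<Sum>l = 1..nfac D. \<Sum>m = 1..<l.
            lam_mu D j l * lam_mu D j m
            * (eps_hi D j * v_Psi v 1 j l m - eps_lo D j * v_Psi v 2 j l m))
     = v_alpha v j
        + v_delta v 1 j * (mean_fn D y j + eps_mu D j)
        - v_delta v 2 j * (mean_fn D y j - eps_mu D j)
        + v_gamma v 1 j * (var_fn D y j + (mean_fn D y j)\<^sup>2) * eps_hi D j
        - v_gamma v 2 j * (var_fn D y j + (mean_fn D y j)\<^sup>2) * eps_lo D j"
    (is "_ + _ - _ + _ * ?sD + _ + ?sG + _ * ?sP = _")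
    if j: "j \<in> sites D" for j
  proof -
    define g where "g = eps_hi D j * v_gamma v 1 j - eps_lo D j * v_gamma v 2 j"
    define S where "S = (\<Sum>i\<in>facs D. lam_mu D j i * y i)"
    define L where "L = (\<Sum>i\<in>facs D. lam_big D j i * y i)"
    define C where "C = (\<Sum>l = 1..nfac D. \<Sum>m = 1..<l. lam_mu D j l * lam_mu D j m * (y l * y m))"
    have \<Delta>: "?sD = (v_delta v 1 j - v_delta v 2 j) * S"
      unfolding S_def sum_distrib_left using v j
      by (intro sum.cong) (auto simp: products_exact_def algebra_simps)
    have \<Gamma>: "?sG = g * L"
      unfolding L_def sum_distrib_left g_def using v j
      by (intro sum.cong) (auto simp: products_exact_def algebra_simps)
    have \<Psi>: "?sP = g * C"
      unfolding C_def sum_distrib_left g_def using v j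
      by (intro sum.cong) (auto simp: products_exact_def facs_def algebra_simps)
    have M: "var_fn D y j + (mean_fn D y j)\<^sup>2
        = (var_bar D j + (mu_bar D j)\<^sup>2) + L + 2 * (mu_bar D j)\<^sup>2 * C"
      unfolding L_def C_def by (rule second_moment_expansion[OF wf y])
    have \<mu>: "mean_fn D y j = mu_bar D j * (1 + S)"
      by (simp add: mean_fn_def S_def)
    show ?thesis
      unfolding M \<Delta> \<Gamma> \<Psi> unfolding \<mu> g_def by (simp add: algebra_simps)
  qed
  then show ?thesis
    unfolding milp_objective_def dual_objective_def dual_truncate_simps
    by (intro arg_cong2[where f = "(+)"] refl sum.cong)
qed

section \<open>Equivalence of the two problems\<close>

text \<open>
  For a fixed decision both problems attain the same value, which is the opening cost plus the
  worst-case expectation \<open>V\<close>.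
\<close>

lemma fixed_decision_equivalence:
  fixes D :: "'j fl_data"
  assumes wf: "well_formed D" and B: "valid_bounds D B" and y: "y \<in> decisions D"
    and Q: "\<And>\<pi>. \<pi> \<in> ambiguity_set D y \<Longrightarrow> has_marginals D \<pi> (Q y \<pi>)"
  obtains V \<pi> v where "\<pi> \<in> ambiguity_set D y" "expected_cost D Q y \<pi> = V"
    "\<forall>\<pi>'\<in>ambiguity_set D y. expected_cost D Q y \<pi>' \<le> V"
    "milp_feasible D B y v" "milp_objective D y v = (\<Sum>i\<in>facs D. open_cost D i * y i) + V"
    "\<forall>v'. milp_feasible D B y v' \<longrightarrow> milp_objective D y v \<le> milp_objective D y v'"
proof -
  obtain u where u: "dual_feasible D y u"
      "\<And>v'. dual_feasible D y v' \<Longrightarrow> dual_objective D y u \<le> dual_objective D y v'"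
      "\<forall>h\<in>{1, 2}. \<forall>j\<in>sites D. v_delta u h j \<le> ub_delta B h j \<and> v_gamma u h j \<le> ub_gamma B h j"
    using B y unfolding valid_bounds_def by meson
  define v :: "'j milp_vars" where "v =
    \<lparr>v_alpha = v_alpha u, v_delta = v_delta u, v_gamma = v_gamma u,
     v_Delta = (\<lambda>h j i. v_delta u h j * y i), v_Gamma = (\<lambda>h j i. v_gamma u h j * y i),
     v_Psi = (\<lambda>h j l m. v_gamma u h j * (y l * y m))\<rparr>"
  have tr: "dual_vars.truncate v = u"
    by (simp add: v_def dual_vars.truncate_def)
  have exact: "products_exact D y v"
    by (simp add: products_exact_def v_def)
  have feas: "milp_feasible D B y v"
    unfolding milp_feasible_iff[OF wf y] tr using u exact by (simp add: v_def)
  have obj: "milp_objective D y v = (\<Sum>i\<in>facs D. open_cost D i * y i) + dual_objective D y u"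
    unfolding milp_objective_eq[OF wf y exact] tr ..
  obtain \<pi> where \<pi>: "\<pi> \<in> ambiguity_set D y" "expected_cost D Q y \<pi> = dual_objective D y u"
    using worst_case_eq_dual(2)[where Q = Q, OF wf y u(1,2) Q] by auto
  have worst: "\<forall>\<pi>'\<in>ambiguity_set D y. expected_cost D Q y \<pi>' \<le> dual_objective D y u"
    using worst_case_eq_dual(1)[where Q = Q, OF wf y u(1,2) Q] by blast
  have opt: "\<forall>v'. milp_feasible D B y v' \<longrightarrow> milp_objective D y v \<le> milp_objective D y v'"
  proof (intro allI impI)
    fix v' assume "milp_feasible D B y v'"
    then have v': "dual_feasible D y (dual_vars.truncate v')" "products_exact D y v'"
      unfolding milp_feasible_iff[OF wf y] by auto
    show "milp_objective D y v \<le> milp_objective D y v'"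
      unfolding obj milp_objective_eq[OF wf y v'(2)] using u(2)[OF v'(1)] by simp
  qed
  show thesis
    by (rule that[OF \<pi> worst feas obj opt])
qed

theorem theorem2:
  fixes D :: "'j fl_data" and B :: "'j dual_bounds"
    and Q :: "(nat \<Rightarrow> real) \<Rightarrow> ('j \<Rightarrow> nat \<Rightarrow> real) \<Rightarrow> ('j \<Rightarrow> real) pmf"
  assumes "well_formed D"
    and "valid_bounds D B"
    and "\<And>y \<pi>. y \<in> decisions D \<Longrightarrow> \<pi> \<in> ambiguity_set D y \<Longrightarrow> has_marginals D \<pi> (Q y \<pi>)"
  shows "(\<forall>y\<in>decisions D.
            dro_objective D Q y
              = (INF v\<in>{v. milp_feasible D B y v}. ereal (milp_objective D y v)) \<and>
            (\<exists>\<pi>\<in>ambiguity_set D y. \<forall>\<pi>'\<in>ambiguity_set D y.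
               expected_cost D Q y \<pi>' \<le> expected_cost D Q y \<pi>) \<and>
            (\<exists>v. milp_feasible D B y v \<and>
               (\<forall>v'. milp_feasible D B y v' \<longrightarrow> milp_objective D y v \<le> milp_objective D y v'))) \<and>
         (INF y\<in>decisions D. dro_objective D Q y)
           = (INF (y, v)\<in>{(y, v). milp_feasible D B y v}. ereal (milp_objective D y v)) \<and>
         {y. dro_optimal D Q y} = {y. \<exists>v. milp_optimal D B y v}"
proof -
  note wf = assms(1) and B = assms(2) and Q = assms(3)
  have attained: "\<exists>\<pi>\<in>ambiguity_set D y. \<forall>\<pi>'\<in>ambiguity_set D y.
        expected_cost D Q y \<pi>' \<le> expected_cost D Q y \<pi>"
    and milp: "\<exists>v. milp_feasible D B y v \<and> dro_objective D Q y = ereal (milp_objective D y v) \<and>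
        (\<forall>v'. milp_feasible D B y v' \<longrightarrow> milp_objective D y v \<le> milp_objective D y v')"
    if y: "y \<in> decisions D" for y
  proof -
    obtain V \<pi> v where \<pi>: "\<pi> \<in> ambiguity_set D y" "expected_cost D Q y \<pi> = V"
        "\<forall>\<pi>'\<in>ambiguity_set D y. expected_cost D Q y \<pi>' \<le> V"
      and v: "milp_feasible D B y v" "milp_objective D y v = (\<Sum>i\<in>facs D. open_cost D i * y i) + V"
        "\<forall>v'. milp_feasible D B y v' \<longrightarrow> milp_objective D y v \<le> milp_objective D y v'"
      by (rule fixed_decision_equivalence[where Q = Q, OF wf B y Q[OF y]])
    show "\<exists>\<pi>\<in>ambiguity_set D y. \<forall>\<pi>'\<in>ambiguity_set D y.
        expected_cost D Q y \<pi>' \<le> expected_cost D Q y \<pi>"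
      using \<pi> by blast
    have "(SUP \<pi>\<in>ambiguity_set D y. ereal (expected_cost D Q y \<pi>)) = ereal V"
      using \<pi> by (intro antisym SUP_least SUP_upper2[OF \<pi>(1)]) auto
    then have "dro_objective D Q y = ereal (milp_objective D y v)"
      by (simp add: dro_objective_def v(2))
    with v show "\<exists>v. milp_feasible D B y v \<and> dro_objective D Q y = ereal (milp_objective D y v) \<and>
        (\<forall>v'. milp_feasible D B y v' \<longrightarrow> milp_objective D y v \<le> milp_objective D y v')"
      by blast
  qed
  have dec: "y \<in> decisions D" if "milp_feasible D B y v" for y v
    using that by (simp add: milp_feasible_def)
  have le: "dro_objective D Q y \<le> ereal (milp_objective D y v)" if "milp_feasible D B y v" for y v
    using milp[OF dec[OF that]] that by auto
  have inf: "dro_objective D Q y = (INF v\<in>{v. milp_feasible D B y v}. ereal (milp_objective D y v))"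
    if y: "y \<in> decisions D" for y
  proof (rule antisym)
    show "dro_objective D Q y \<le> (INF v\<in>{v. milp_feasible D B y v}. ereal (milp_objective D y v))"
      using le by (intro INF_greatest) auto
    show "(INF v\<in>{v. milp_feasible D B y v}. ereal (milp_objective D y v)) \<le> dro_objective D Q y"
      using milp[OF y] by (auto intro: INF_lower)
  qed
  have total: "(INF y\<in>decisions D. dro_objective D Q y)
      = (INF (y, v)\<in>{(y, v). milp_feasible D B y v}. ereal (milp_objective D y v))"
  proof (rule antisym)
    show "(INF y\<in>decisions D. dro_objective D Q y)
        \<le> (INF (y, v)\<in>{(y, v). milp_feasible D B y v}. ereal (milp_objective D y v))"
    proof (rule INF_greatest, clarify)
      fix y v assume "milp_feasible D B y v"
      then show "(INF y\<in>decisions D. dro_objective D Q y) \<le> ereal (milp_objective D y v)"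
        by (intro INF_lower2[OF dec le])
    qed
    show "(INF (y, v)\<in>{(y, v). milp_feasible D B y v}. ereal (milp_objective D y v))
        \<le> (INF y\<in>decisions D. dro_objective D Q y)"
    proof (rule INF_greatest)
      fix y assume "y \<in> decisions D"
      then obtain v where v: "milp_feasible D B y v"
          "dro_objective D Q y = ereal (milp_objective D y v)"
        using milp by blast
      show "(INF (y, v)\<in>{(y, v). milp_feasible D B y v}. ereal (milp_objective D y v))
          \<le> dro_objective D Q y"
        using v by (intro INF_lower2[of "(y, v)"]) auto
    qed
  qed
  have opt: "dro_optimal D Q y \<longleftrightarrow> (\<exists>v. milp_optimal D B y v)" for y
  proof
    assume y: "dro_optimal D Q y"
    then obtain v where v: "milp_feasible D B y v"
        "dro_objective D Q y = ereal (milp_objective D y v)"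
      using milp unfolding dro_optimal_def by blast
    have "milp_objective D y v \<le> milp_objective D y' v'" if "milp_feasible D B y' v'" for y' v'
    proof -
      have "dro_objective D Q y \<le> dro_objective D Q y'"
        using y dec[OF that] by (simp add: dro_optimal_def)
      then have "ereal (milp_objective D y v) \<le> ereal (milp_objective D y' v')"
        using le[OF that] v(2) by (metis order_trans)
      then show ?thesis by simp
    qed
    with v(1) show "\<exists>v. milp_optimal D B y v"
      unfolding milp_optimal_def by blast
  next
    assume "\<exists>v. milp_optimal D B y v"
    then obtain v where v: "milp_feasible D B y v"
        "\<And>y' v'. milp_feasible D B y' v' \<Longrightarrow> milp_objective D y v \<le> milp_objective D y' v'"
      unfolding milp_optimal_def by blast
    have "dro_objective D Q y \<le> dro_objective D Q y'" if y': "y' \<in> decisions D" for y'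
    proof -
      obtain v' where v': "milp_feasible D B y' v'"
          "dro_objective D Q y' = ereal (milp_objective D y' v')"
        using milp[OF y'] by blast
      show ?thesis
        using le[OF v(1)] v(2)[OF v'(1)] v'(2) by (metis ereal_less_eq(3) order_trans)
    qed
    then show "dro_optimal D Q y"
      using dec[OF v(1)] by (simp add: dro_optimal_def)
  qed
  show ?thesis
  proof (intro conjI ballI)
    fix y assume y: "y \<in> decisions D"
    show "dro_objective D Q y = (INF v\<in>{v. milp_feasible D B y v}. ereal (milp_objective D y v))"
      by (rule inf[OF y])
    show "\<exists>\<pi>\<in>ambiguity_set D y. \<forall>\<pi>'\<in>ambiguity_set D y.
        expected_cost D Q y \<pi>' \<le> expected_cost D Q y \<pi>"
      by (rule attained[OF y])
    show "\<exists>v. milp_feasible D B y v \<and>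
        (\<forall>v'. milp_feasible D B y v' \<longrightarrow> milp_objective D y v \<le> milp_objective D y v')"
      using milp[OF y] by blast
  qed (use total opt in auto)
qed

end
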